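(* Let $X$ be a bounded geometry metric space. If $X$ has property $ULA_\mu$, then $X$ has property $ULA$.
   Context: A metric space $X$ has bounded geometry if for all $R>0$ there is $N_R\in\mathbb{N}$ such that every closed ball of radius $R$ in $X$ has at most $N_R$ points. For $E\subseteq X$ and $R>0$: $N_R(E)=\{y\in X: d(y,E)\le R\}$ and $\partial_RE=N_R(E)\setminus E$. $ULA_\mu$: for all $R,\epsilon>0$ there exists $S>0$ such that for all probability measures $\mu$ on $X$ there exists a finite set $E\subseteq X$ with $\mathrm{diam}(E)\le S$ and $\mu(\partial_RE)<\epsilon\,\mu(E)$. $ULA$: for all $R,\epsilon>0$ there exists $S>0$ such that for all finite nonempty subsets $F$ of $X$ there exists a finite set $E\subseteq X$ with $\mathrm{diam}(E)\le S$ and $|\partial_RE\cap F|<\epsilon|E\cap F|$. *)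

theory Defs
  imports "HOL-Probability.Probability"
begin

text \<open>
  A metric space is a set \<open>X\<close> in a type of class \<open>metric_space\<close>, with the restricted metric;
  a type as a whole is the case \<open>X = UNIV\<close>, and the empty space is included.
\<close>

definition bounded_geometry :: "'a::metric_space set \<Rightarrow> bool" where
  "bounded_geometry X \<longleftrightarrow>
     (\<forall>R>0. \<exists>N::nat. \<forall>x\<in>X. finite (X \<inter> cball x R) \<and> card (X \<inter> cball x R) \<le> N)"

text \<open>
  The distance to the empty set is infinite, so its neighbourhoods are empty. This has to be said
  separately because \<^const>\<open>infdist\<close> to the empty set is 0.
\<close>

definition nbhd :: "'a::metric_space set \<Rightarrow> real \<Rightarrow> 'a set \<Rightarrow> 'a set" where
  "nbhd X R E = {y \<in> X. E \<noteq> {} \<and> infdist y E \<le> R}"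

definition bdry :: "'a::metric_space set \<Rightarrow> real \<Rightarrow> 'a set \<Rightarrow> 'a set" where
  "bdry X R E = nbhd X R E - E"

text \<open>
  Probability measures on \<open>X\<close> are Borel; the sets measured below are Borel because \<open>E\<close> is finite.
  If \<open>X\<close> has bounded geometry, it is countable and discrete, so all its subsets are Borel.
\<close>

definition ULA_mu :: "'a::metric_space set \<Rightarrow> bool" where
  "ULA_mu X \<longleftrightarrow>
     (\<forall>R>0. \<forall>\<epsilon>>0. \<exists>S>0. \<forall>\<mu> :: 'a measure.
        prob_space \<mu> \<and> space \<mu> = X \<and> sets \<mu> = sets (restrict_space borel X) \<longrightarrow>
        (\<exists>E. finite E \<and> E \<subseteq> X \<and> diameter E \<le> S \<and>
             measure \<mu> (bdry X R E) < \<epsilon> * measure \<mu> E))"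

definition ULA :: "'a::metric_space set \<Rightarrow> bool" where
  "ULA X \<longleftrightarrow>
     (\<forall>R>0. \<forall>\<epsilon>>0. \<exists>S>0. \<forall>F. finite F \<and> F \<noteq> {} \<and> F \<subseteq> X \<longrightarrow>
        (\<exists>E. finite E \<and> E \<subseteq> X \<and> diameter E \<le> S \<and>
             real (card (bdry X R E \<inter> F)) < \<epsilon> * real (card (E \<inter> F))))"

end

theory Submission
  imports Defs
begin

text \<open>Counting in a finite nonempty set F is integration against a probability measure: the
  uniform measure on F, seen as a measure on X, gives A the mass |A \<inter> F| / |F|. Applying
  \<open>ULA_mu\<close> to this measure and multiplying the resulting inequality by |F| gives the
  inequality of \<open>ULA\<close>, with the same E and the same S. The scale S does not depend on F
  because \<open>ULA_mu\<close> fixes it before the measure is chosen. What remains is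
  measure-theoretic: the measure must live on the Borel sets of X
  (\<open>prob_space_uniform_on\<close>), and its value is the expected ratio only on measurable
  sets (\<open>measure_uniform_on\<close>), so E and its boundary must be shown to be Borel.\<close>

lemma finite_in_sets_restrict_borel:
  fixes E :: "'a::t1_space set"
  assumes "finite E" "E \<subseteq> X"
  shows "E \<in> sets (restrict_space borel X)"
proof -
  have "E \<in> sets borel"
    using assms(1) by (intro borel_closed finite_imp_closed)
  moreover have "E = X \<inter> E"
    using assms(2) by auto
  ultimately show ?thesis
    unfolding sets_restrict_space by (rule rev_image_eqI)
qed

text \<open>Distance to E is continuous, so for nonempty E the neighbourhood is the trace on X of a
  closed set, and the finite set E is removed from it. The empty set is treated apart: there
  \<open>infdist\<close> is 0, but the boundary is empty by definition.\<close>

lemma bdry_in_sets_restrict_borel: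
  fixes E :: "'a::metric_space set"
  assumes "finite E" "E \<subseteq> X"
  shows "bdry X R E \<in> sets (restrict_space borel X)"
proof (cases "E = {}")
  case False
  have "closed {y. infdist y E \<le> R}"
    by (intro closed_Collect_le continuous_intros)
  then have "X \<inter> {y. infdist y E \<le> R} \<in> sets (restrict_space borel X)"
    unfolding sets_restrict_space by (intro imageI borel_closed)
  moreover have "bdry X R E = (X \<inter> {y. infdist y E \<le> R}) - E"
    using False by (auto simp: bdry_def nbhd_def)
  ultimately show ?thesis
    using finite_in_sets_restrict_borel[OF assms] by (simp only: sets.Diff)
qed (simp add: bdry_def nbhd_def)

text \<open>\<open>uniform_count_measure F\<close> has space F and all subsets of F as measurable
  sets. Pushing it forward along the inclusion of F in X yields the space and the sigma-algebra that
  \<open>ULA_mu\<close> demands.\<close>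

definition uniform_on :: "'a::topological_space set \<Rightarrow> 'a set \<Rightarrow> 'a measure" where
  "uniform_on X F = distr (uniform_count_measure F) (restrict_space borel X) (\<lambda>x. x)"

lemma space_uniform_on [simp]: "space (uniform_on X F) = X"
  by (simp add: uniform_on_def space_restrict_space)

lemma sets_uniform_on [simp]: "sets (uniform_on X F) = sets (restrict_space borel X)"
  by (simp add: uniform_on_def)

lemma measurable_uniform_count_inclusion:
  assumes "F \<subseteq> X"
  shows "(\<lambda>x. x) \<in> measurable (uniform_count_measure F) (restrict_space borel X)"
  using assms
  by (auto simp: measurable_def space_uniform_count_measure sets_uniform_count_measure space_restrict_space)

lemma prob_space_uniform_on:
  assumes "finite F" "F \<noteq> {}" "F \<subseteq> X"
  shows "prob_space (uniform_on X F)"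
  unfolding uniform_on_def
  using assms
  by (intro prob_space.prob_space_distr prob_space_uniform_count_measure measurable_uniform_count_inclusion)

text \<open>The preimage of A under the inclusion is A \<inter> F. Measurability of A matters, since
  \<open>measure\<close> takes the default value 0 on non-measurable sets.\<close>

lemma measure_uniform_on:
  assumes "finite F" "F \<subseteq> X" "A \<in> sets (restrict_space borel X)"
  shows "measure (uniform_on X F) A = card (A \<inter> F) / card F"
  unfolding uniform_on_def
  using assms
  by (simp add: measure_distr[OF measurable_uniform_count_inclusion] measure_uniform_count_measure space_uniform_count_measure)

theorem lemma2p7:
  fixes X :: "'a::metric_space set"
  assumes "bounded_geometry X"
    and "ULA_mu X"
  shows "ULA X"
  unfolding ULA_def
proof (intro allI impI)
  fix R \<epsilon> :: real
  assume "R > 0" "\<epsilon> > 0"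
  with assms(2) have "\<exists>S>0. \<forall>\<mu> :: 'a measure.
      prob_space \<mu> \<and> space \<mu> = X \<and> sets \<mu> = sets (restrict_space borel X) \<longrightarrow>
      (\<exists>E. finite E \<and> E \<subseteq> X \<and> diameter E \<le> S \<and> measure \<mu> (bdry X R E) < \<epsilon> * measure \<mu> E)"
    (is "\<exists>S>0. ?P S")
    unfolding ULA_mu_def by (elim allE impE)
  \<comment> \<open>This S serves every probability measure on X, hence every F below.\<close>
  then obtain S where "S > 0" and S: "?P S"
    by (elim exE conjE)
  have "\<exists>E. finite E \<and> E \<subseteq> X \<and> diameter E \<le> S \<and>
      real (card (bdry X R E \<inter> F)) < \<epsilon> * real (card (E \<inter> F))"
    if F: "finite F" "F \<noteq> {}" "F \<subseteq> X" for F
  proof -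
    \<comment> \<open>The choice \<mu> = \<open>uniform_on X F\<close> is made by unification, while
      the three conjuncts of the premise of \<open>S\<close> are discharged.\<close>
    obtain E where E: "finite E" "E \<subseteq> X" "diameter E \<le> S"
      and less: "measure (uniform_on X F) (bdry X R E) < \<epsilon> * measure (uniform_on X F) E"
      using S[rule_format, OF conjI, OF prob_space_uniform_on[OF F] conjI, OF space_uniform_on sets_uniform_on]
      by blast
    have "card (bdry X R E \<inter> F) / card F < \<epsilon> * (card (E \<inter> F) / card F)"
      using less
      unfolding measure_uniform_on[OF F(1,3) bdry_in_sets_restrict_borel[OF E(1,2)]]
        measure_uniform_on[OF F(1,3) finite_in_sets_restrict_borel[OF E(1,2)]] .
    \<comment> \<open>Both sides carry the denominator |F|; being positive, it cancels without
      reversing the strict inequality.\<close>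
    moreover have "card F > 0"
      using F by (simp add: card_gt_0_iff)
    ultimately have "card (bdry X R E \<inter> F) < \<epsilon> * card (E \<inter> F)"
      by (simp add: divide_less_cancel)
    with E show ?thesis
      by blast
  qed
  then show "\<exists>S>0. \<forall>F. finite F \<and> F \<noteq> {} \<and> F \<subseteq> X \<longrightarrow>
      (\<exists>E. finite E \<and> E \<subseteq> X \<and> diameter E \<le> S \<and>
           real (card (bdry X R E \<inter> F)) < \<epsilon> * real (card (E \<inter> F)))"
    using \<open>S > 0\<close> by blast
qed

end
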